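(* For any positive integers $k$ and $\Delta$, the set of all finite connected undirected graphs (up to isomorphism) with algebraic degree at most $k$ and maximum degree at most $\Delta$ is finite.
   Context: Graphs are finite, loop-free and without multiple edges. For a graph $\Gamma$, the splitting field $\mathbb{SF}(\Gamma)$ is the smallest field extension of $\mathbb{Q}$ containing all eigenvalues of the adjacency matrix of $\Gamma$; the algebraic degree of $\Gamma$ is $\deg(\Gamma)=[\mathbb{SF}(\Gamma):\mathbb{Q}]$. *)

theory Defs
  imports
    "Graph_Theory.Graph_Theory"
    "Jordan_Normal_Form.Spectral_Radius"
    "HOL-Algebra.Finite_Extensions"
    "HOL-Algebra.Generated_Fields"
    "HOL-Algebra.Algebraic_Closure_Type"
begin

text \<open>
  A finite simple undirected graph is a \<^typ>\<open>'a pair_pre_digraph\<close> satisfying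
  \<^const>\<open>pair_graph\<close>: a finite vertex set together with a symmetric, irreflexive set of
  ordered pairs of vertices, each edge being represented by its two orientations.
\<close>

definition vertex_list :: "'a pair_pre_digraph \<Rightarrow> 'a list" where
  "vertex_list G = (SOME vs. distinct vs \<and> set vs = pverts G)"

lemma vertex_list:
  assumes "finite (pverts G)"
  shows "distinct (vertex_list G)" "set (vertex_list G) = pverts G"
proof -
  from finite_distinct_list[OF assms] have "\<exists>vs. distinct vs \<and> set vs = pverts G" by blast
  then have "distinct (vertex_list G) \<and> set (vertex_list G) = pverts G"
    unfolding vertex_list_def by (rule someI_ex)
  then show "distinct (vertex_list G)" "set (vertex_list G) = pverts G" by blast+
qed

text \<open>
  The matrix depends on the chosen enumeration of the vertices only up to simultaneous
  permutation of rows and columns, so its spectrum does not depend on the choice. The entries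
  are complex in order that the spectrum consists of all eigenvalues.
\<close>

definition adjacency_matrix :: "'a pair_pre_digraph \<Rightarrow> complex mat" where
  "adjacency_matrix G = (let vs = vertex_list G; n = length vs in
     mat n n (\<lambda>(i, j). if (vs ! i, vs ! j) \<in> parcs G then 1 else 0))"

abbreviation complex_ring :: "complex ring" where
  "complex_ring \<equiv> ring_of_type_algebra"

text \<open>
  \<^const>\<open>generate_field\<close> yields the smallest subfield of the complex numbers containing the given
  set; it contains the rationals automatically.
\<close>

definition splitting_field :: "'a pair_pre_digraph \<Rightarrow> complex set" where
  "splitting_field G = generate_field complex_ring (spectrum (adjacency_matrix G))"

definition algebraic_degree :: "'a pair_pre_digraph \<Rightarrow> nat" where
  "algebraic_degree G = ring.dim complex_ring \<rat> (splitting_field G)"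

text \<open>
  In a symmetric digraph the out-degree of a vertex is its number of neighbours.
\<close>

definition max_degree :: "'a pair_pre_digraph \<Rightarrow> nat" where
  "max_degree G = Max (out_degree (with_proj G) ` pverts G)"

definition graph_iso_rel :: "('a pair_pre_digraph \<times> 'a pair_pre_digraph) set" where
  "graph_iso_rel = {(G, H). pair_graph G \<and> pair_graph H \<and> digraph_iso (with_proj G) (with_proj H)}"


lemma equiv_graph_iso_rel:
  "equiv {G :: 'a pair_pre_digraph. pair_graph G} graph_iso_rel"
proof (rule equivI)
  have wf: "wf_digraph (with_proj G)" if "pair_graph G" for G :: "'a pair_pre_digraph"
    using that by (simp add: pair_graph_def pair_digraph_def pair_fin_digraph_def wf_digraph_wp_iff)
  show "graph_iso_rel \<subseteq> {G :: 'a pair_pre_digraph. pair_graph G} \<times> {G. pair_graph G}"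
    by (auto simp: graph_iso_rel_def)
  have "digraph_iso (with_proj G) (with_proj G)" if "pair_graph G" for G :: "'a pair_pre_digraph"
    unfolding digraph_iso_def
  proof (intro exI conjI)
    let ?f = "\<lparr>iso_verts = id, iso_arcs = id, iso_head = snd, iso_tail = fst\<rparr>"
    show "pre_digraph.digraph_isomorphism (with_proj G) ?f"
      using wf[OF that] by (simp add: pre_digraph.digraph_isomorphism_def)
    show "with_proj G = app_iso ?f (with_proj G)"
      by (simp add: app_iso_def with_proj_def)
  qed
  then show "refl_on {G :: 'a pair_pre_digraph. pair_graph G} graph_iso_rel"
    by (auto simp: graph_iso_rel_def refl_on_def)
  show "sym (graph_iso_rel :: ('a pair_pre_digraph \<times> _) set)"
    by (rule symI) (auto simp: graph_iso_rel_def intro: digraph_iso_swap wf)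
  show "trans (graph_iso_rel :: ('a pair_pre_digraph \<times> _) set)"
    by (rule transI) (auto simp: graph_iso_rel_def intro: digraph_iso_trans)
qed
end

(*
  Let G be connected with maximum degree at most D and algebraic degree at most k.
  An eigenvalue z of G is a root of an integer polynomial of degree at most k, because 1, z, ..., z^k
  are linearly dependent over the rationals. A primitive such polynomial of least degree divides the
  characteristic polynomial of the adjacency matrix, so it is monic up to sign and its roots are
  eigenvalues, hence bounded by D. Its coefficients are then bounded in terms of k and D. Thus the
  eigenvalues of all these graphs together form a finite set.

  Let A be the adjacency operator and e_u the indicator function of a vertex u. A nonzero polynomial p
  of least degree with p(A) e_u = 0 has only eigenvalues as roots, and as A is self-adjoint they are
  simple. So m = deg p is at most the number of distinct eigenvalues. The value of A^i e_u at v counts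
  the walks of length i from v to u; hence every vertex with a walk of length m to u also has a
  shorter one, and by connectedness all vertices lie within distance m - 1 of u. This bounds the
  number of vertices.
*)
theory Submission
  imports Defs
begin

hide_const (open) Polynomials.degree Polynomials.lead_coeff up_ring.coeff up_ring.monom module.smult

subsection \<open>Algebraic integers with bounded degree and conjugates\<close>

text \<open>Splitting off a root r makes each coefficient of p a coefficient of the cofactor minus r
  times the next one, so every linear factor costs at most a factor 1 + |B|. The absolute value
  keeps this base at least 1 even for constant p, where the hypothesis on roots says nothing about
  B.\<close>

lemma norm_coeff_le_of_roots_bounded:
  fixes p :: "complex poly"
  assumes "lead_coeff p = 1" "\<And>z. poly p z = 0 \<Longrightarrow> norm z \<le> B"
  shows "norm (coeff p i) \<le> (1 + \<bar>B\<bar>) ^ degree p"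
  using assms
proof (induction "degree p" arbitrary: p i)
  case 0
  then obtain c where "p = [:c:]" by (metis degree_eq_zeroE)
  with 0 show ?case by (cases i) auto
next
  case (Suc n)
  have "\<not> constant (poly p)" using Suc.hyps(2) by (simp add: constant_degree)
  then obtain r where r: "poly p r = 0" using fundamental_theorem_of_algebra by blast
  then obtain q where q: "p = [:- r, 1:] * q" by (auto simp: poly_eq_0_iff_dvd elim: dvdE)
  have nz: "q \<noteq> 0" using Suc.hyps(2) q by auto
  have dq: "degree q = n" using nz Suc.hyps(2) unfolding q by (subst (asm) degree_mult_eq) auto
  have lq: "lead_coeff q = 1" using Suc.prems(1) unfolding q lead_coeff_mult by simp
  have IH: "norm (coeff q j) \<le> (1 + \<bar>B\<bar>) ^ n" for j
    using Suc.hyps(1)[of q j] dq lq Suc.prems(2) q by auto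
  have rB: "norm r \<le> \<bar>B\<bar>" using Suc.prems(2)[OF r] by linarith
  have "coeff p i = (case i of 0 \<Rightarrow> 0 | Suc j \<Rightarrow> coeff q j) - r * coeff q i"
    unfolding q by (simp add: coeff_pCons split: nat.splits)
  also have "norm \<dots> \<le> (1 + \<bar>B\<bar>) ^ n + \<bar>B\<bar> * (1 + \<bar>B\<bar>) ^ n"
    using IH rB by (intro order.trans[OF norm_triangle_ineq4] add_mono)
      (auto simp: norm_mult split: nat.splits intro!: mult_mono)
  also have "\<dots> = (1 + \<bar>B\<bar>) ^ degree p" by (simp add: Suc.hyps(2)[symmetric] algebra_simps)
  finally show ?case .
qed

lemma finite_int_polys_bounded:
  "finite {p :: int poly. degree p \<le> k \<and> (\<forall>i. \<bar>real_of_int (coeff p i)\<bar> \<le> C)}"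
proof (rule finite_subset)
  show "{p :: int poly. degree p \<le> k \<and> (\<forall>i. \<bar>real_of_int (coeff p i)\<bar> \<le> C)}
      \<subseteq> Poly ` {xs. set xs \<subseteq> {- \<lfloor>C\<rfloor>..\<lfloor>C\<rfloor>} \<and> length xs \<le> Suc k}"
  proof clarify
    fix p :: "int poly" assume p: "degree p \<le> k" "\<forall>i. \<bar>real_of_int (coeff p i)\<bar> \<le> C"
    have "coeff p i \<in> {- \<lfloor>C\<rfloor>..\<lfloor>C\<rfloor>}" for i
      using p(2)[rule_format, of i] by (simp add: abs_le_iff le_floor_iff minus_le_iff[of "\<lfloor>C\<rfloor>"])
    then have "set (coeffs p) \<subseteq> {- \<lfloor>C\<rfloor>..\<lfloor>C\<rfloor>}" unfolding coeffs_def by auto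
    moreover have "length (coeffs p) \<le> Suc k" using p(1) by (cases "p = 0") (auto simp: length_coeffs)
    ultimately show "p \<in> Poly ` {xs. set xs \<subseteq> {- \<lfloor>C\<rfloor>..\<lfloor>C\<rfloor>} \<and> length xs \<le> Suc k}"
      by (intro image_eqI[of _ _ "coeffs p"]) auto
  qed
  show "finite (Poly ` {xs. set xs \<subseteq> {- \<lfloor>C\<rfloor>..\<lfloor>C\<rfloor>} \<and> length xs \<le> Suc k})"
    by (intro finite_imageI finite_lists_length_le) simp
qed

text \<open>Gauss's lemma: contents are multiplicative, so c divides the content of the cofactor of
  g and can be cancelled.\<close>

lemma primitive_dvd_of_dvd_smult:
  fixes g p :: "int poly"
  assumes "g dvd smult c p" "content g = 1" "c \<noteq> 0"
  shows "g dvd p"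
proof -
  obtain q where q: "smult c p = g * q" using assms(1) by (elim dvdE)
  from arg_cong[OF q, of content] have "\<bar>c\<bar> * content p = content q"
    by (simp add: content_mult assms(2))
  then have "c dvd content q" by (metis dvd_triv_left abs_dvd_iff)
  then have "[:c:] dvd q" by (simp add: const_poly_dvd_iff_dvd_content)
  then obtain s where "q = [:c:] * s" by (elim dvdE)
  then have "smult c p = smult c (g * s)" using q by simp
  then have "p = g * s" using assms(3) by (metis smult_cancel)
  then show ?thesis by simp
qed

text \<open>Here g plays the role of the minimal polynomial of z over the integers: it is the
  primitive part of a nonzero integer polynomial of least degree vanishing at z. Pseudo-division of
  \<chi> by g leaves a remainder that vanishes at z and has smaller degree, hence is zero.\<close>

lemma exists_int_poly_dvd_of_root:
  fixes \<chi> f :: "int poly" and z :: complex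
  assumes "lead_coeff \<chi> = 1" "poly (of_int_poly \<chi>) z = 0"
    and "f \<noteq> 0" "poly (of_int_poly f) z = 0"
  obtains g where "g dvd \<chi>" "degree g \<le> degree f" "poly (of_int_poly g) z = 0"
proof -
  define P where "P = (\<lambda>g::int poly. g \<noteq> 0 \<and> poly (of_int_poly g) z = 0)"
  obtain g0 where g0: "P g0" "\<And>h. P h \<Longrightarrow> degree g0 \<le> degree h"
    using ex_has_least_nat[of P f degree] assms(3,4) unfolding P_def by metis
  define g where "g = primitive_part g0"
  have "of_int_poly g0 = smult (complex_of_int (content g0)) (of_int_poly g)"
    unfolding g_def by (metis content_times_primitive_part of_int_hom.map_poly_hom_smult)
  then have gz: "poly (of_int_poly g) z = 0" using g0(1) by (auto simp: P_def)
  have g: "g \<noteq> 0" "content g = 1" "degree g = degree g0"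
    using g0(1) by (auto simp: P_def g_def)
  obtain q r where qr: "pseudo_divmod \<chi> g = (q, r)" by fastforce
  \<comment> \<open>The factor by which pseudo-division scales \<chi> in order to stay over the
    integers; primitivity of g removes it again.\<close>
  define c where "c = lead_coeff g ^ (Suc (degree \<chi>) - degree g)"
  from pseudo_divmod[OF g(1) qr] have eq: "smult c \<chi> = g * q + r" and dr: "r = 0 \<or> degree r < degree g"
    by (simp_all add: c_def)
  from arg_cong[OF eq, of "\<lambda>p. poly (of_int_poly p) z"] have "poly (of_int_poly r) z = 0"
    using gz assms(2) by (simp add: of_int_hom.map_poly_hom_smult of_int_poly_hom.hom_add of_int_poly_hom.hom_mult)
  then have "r = 0" using dr g0(2)[of r] g(3) by (auto simp: P_def dest: leD)
  then have "g dvd smult c \<chi>" using eq by simp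
  moreover have "c \<noteq> 0" using g(1) by (simp add: c_def)
  ultimately have "g dvd \<chi>" using g(2) primitive_dvd_of_dvd_smult by blast
  moreover have "degree g \<le> degree f" using g(3) g0(2)[of f] assms(3,4) by (simp add: P_def)
  ultimately show ?thesis using that gz by blast
qed

text \<open>A Northcott-type finiteness statement. The degree of \<chi> is unbounded, but a factor g
  of \<chi> vanishing at z has degree at most that of f, and its roots are roots of \<chi>. This
  leaves finitely many g, each with finitely many roots.\<close>

lemma finite_bounded_degree_bounded_conjugates:
  "finite {z :: complex. \<exists>\<chi> f :: int poly. lead_coeff \<chi> = 1 \<and> poly (of_int_poly \<chi>) z = 0 \<and>
      (\<forall>w :: complex. poly (of_int_poly \<chi>) w = 0 \<longrightarrow> norm w \<le> B) \<and>
      f \<noteq> 0 \<and> degree f \<le> k \<and> poly (of_int_poly f) z = 0}" (is "finite ?Z")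
proof -
  define C where "C = (1 + \<bar>B\<bar>) ^ k"
  define P where "P = {p :: int poly. degree p \<le> k \<and> (\<forall>i. \<bar>real_of_int (coeff p i)\<bar> \<le> C)} - {0}"
  have "?Z \<subseteq> (\<Union>p\<in>P. {z. poly (of_int_poly p) z = 0})"
  proof clarify
    fix z :: complex and \<chi> f :: "int poly"
    assume *: "lead_coeff \<chi> = 1" "poly (of_int_poly \<chi>) z = 0"
      "\<forall>w :: complex. poly (of_int_poly \<chi>) w = 0 \<longrightarrow> norm w \<le> B"
      "f \<noteq> 0" "degree f \<le> k" "poly (of_int_poly f) z = 0"
    then obtain g where g: "g dvd \<chi>" "degree g \<le> degree f" "poly (of_int_poly g) z = 0"
      using exists_int_poly_dvd_of_root by metis
    then obtain h where h: "\<chi> = g * h" by (elim dvdE)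
    then have "lead_coeff g * lead_coeff h = 1" using *(1) by (simp add: lead_coeff_mult)
    then have lc: "\<bar>lead_coeff g\<bar> = 1" by (metis abs_zmult_eq_1 abs_one)
    \<comment> \<open>The leading coefficient of g is 1 or -1, so this scaling makes g monic without
      changing the absolute values of its coefficients.\<close>
    define G where "G = smult (of_int (lead_coeff g)) (of_int_poly g :: complex poly)"
    have lc2: "of_int (lead_coeff g) * of_int (lead_coeff g) = (1 :: complex)"
      using lc by (auto simp: abs_if split: if_splits)
    have G: "lead_coeff G = 1" "degree G = degree g" using lc lc2 by (auto simp: G_def)
    have "norm w \<le> B" if "poly G w = 0" for w
      using that lc *(3) by (auto simp: G_def h of_int_poly_hom.hom_mult)
    then have "norm (coeff G i) \<le> (1 + \<bar>B\<bar>) ^ degree G" for i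
      using norm_coeff_le_of_roots_bounded G by blast
    also have "(1 + \<bar>B\<bar>) ^ degree G \<le> C" unfolding C_def using G g(2) *(5) by (intro power_increasing) auto
    finally have "norm (coeff G i) \<le> C" for i .
    then have "\<bar>real_of_int (coeff g i)\<bar> \<le> C" for i using lc by (simp add: G_def norm_mult flip: of_int_abs)
    then have "g \<in> P" using g(2) *(5) lc by (auto simp: P_def)
    with g(3) show "z \<in> (\<Union>p\<in>P. {z. poly (of_int_poly p) z = 0})" by auto
  qed
  moreover have "finite (\<Union>p\<in>P. {z :: complex. poly (of_int_poly p) z = 0})"
    using finite_int_polys_bounded[of k C] by (auto simp: P_def intro!: poly_roots_finite)
  ultimately show ?thesis by (rule finite_subset)
qed

section \<open>Clearing denominators in rational relations between powers\<close>

lemma common_denominator: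
  assumes "finite S" "S \<subseteq> (\<rat> :: 'a :: field_char_0 set)"
  obtains d :: int where "d \<noteq> 0" "\<And>x. x \<in> S \<Longrightarrow> of_int d * x \<in> \<int>"
  using assms
proof (induction S arbitrary: thesis rule: finite_induct)
  case empty
  show ?case by (rule empty(1)[of 1]) auto
next
  case (insert x S)
  have "x \<in> \<rat>" using insert.prems by simp
  then obtain a b :: int where ab: "b > 0" "x = of_int a / of_int b" by (rule Rats_cases')
  obtain d :: int where d: "d \<noteq> 0" "\<And>x. x \<in> S \<Longrightarrow> of_int d * x \<in> \<int>"
    using insert.IH insert.prems by blast
  show ?case
  proof (rule insert.prems(1)[of "d * b"])
    fix y assume "y \<in> insert x S"
    then consider "y = x" | "y \<in> S" by blast
    then show "of_int (d * b) * y \<in> \<int>"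
    proof cases
      case 1
      then have "of_int (d * b) * y = of_int (d * a)" using ab by simp
      then show ?thesis by (metis Ints_of_int)
    next
      case 2
      have "of_int b * (of_int d * y) \<in> \<int>" using d(2)[OF 2] by (rule Ints_mult[OF Ints_of_int])
      then show ?thesis by (simp add: mult_ac)
    qed
  qed (use ab d in auto)
qed

lemma int_poly_of_rational_relation:
  fixes z :: complex
  assumes "(\<Sum>i\<le>k. c i * z ^ i) = 0" "\<And>i. c i \<in> \<rat>" "i0 \<le> k" "c i0 \<noteq> 0"
  obtains f :: "int poly" where "f \<noteq> 0" "degree f \<le> k" "poly (of_int_poly f) z = 0"
proof -
  obtain d :: int where d: "d \<noteq> 0" "\<And>x. x \<in> c ` {..k} \<Longrightarrow> of_int d * x \<in> \<int>"
    using common_denominator[of "c ` {..k}"] assms(2) by blast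
  then have "\<forall>i\<in>{..k}. \<exists>n. of_int d * c i = of_int n" by (auto elim: Ints_cases)
  then obtain n where n: "\<And>i. i \<le> k \<Longrightarrow> of_int d * c i = of_int (n i)" by (metis atMost_iff)
  define f where "f = (\<Sum>i\<le>k. monom (n i) i)"
  have cf: "coeff f j = (if j \<le> k then n j else 0)" for j
    by (simp add: f_def coeff_sum)
  have "coeff f i0 \<noteq> 0" using n[OF assms(3)] assms(3,4) d(1) by (auto simp: cf)
  then have "f \<noteq> 0" by auto
  moreover have df: "degree f \<le> k" by (rule degree_le) (simp add: cf)
  moreover have "of_int_poly f = (\<Sum>i\<le>k. monom (of_int d * c i) i)"
    by (rule poly_eqI) (simp add: cf n coeff_sum)
  then have "poly (of_int_poly f) z = of_int d * (\<Sum>i\<le>k. c i * z ^ i)"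
    by (simp add: poly_sum poly_monom sum_distrib_left mult.assoc)
  then have "poly (of_int_poly f) z = 0" using assms(1) by simp
  ultimately show ?thesis using that by blast
qed

subsection \<open>The complex numbers as an extension of the rationals\<close>

lemma field_complex_ring: "field complex_ring"
  by (rule field_from_type_algebra)

interpretation CR: domain complex_ring
  by (rule field.axioms(1)[OF field_complex_ring])

lemma complex_ring_simps [simp]:
  "carrier complex_ring = UNIV"
  "x \<otimes>\<^bsub>complex_ring\<^esub> y = x * y"
  "x \<oplus>\<^bsub>complex_ring\<^esub> y = x + y"
  "\<one>\<^bsub>complex_ring\<^esub> = 1"
  "\<zero>\<^bsub>complex_ring\<^esub> = 0"
  by (simp_all add: ring_of_type_algebra_def)

lemma complex_ring_a_inv [simp]: "\<ominus>\<^bsub>complex_ring\<^esub> x = - x"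
  by (rule CR.minus_equality) simp_all

lemma complex_ring_m_inv [simp]: "x \<noteq> 0 \<Longrightarrow> inv\<^bsub>complex_ring\<^esub> x = inverse x"
  by (rule CR.comm_inv_char) simp_all

lemma complex_ring_pow [simp]: "x [^]\<^bsub>complex_ring\<^esub> (n :: nat) = x ^ n"
  by (induction n) (simp_all add: CR.nat_pow_Suc mult.commute)

text \<open>The list polynomials evaluated by \<open>CR.eval\<close> start with the leading
  coefficient, those of \<open>Poly\<close> with the constant one; hence \<open>rev\<close>.\<close>

lemma complex_ring_eval: "CR.eval xs x = poly (Poly (rev xs)) x"
  by (induction xs) (simp_all add: Poly_append poly_monom)

lemma complex_ring_combine:
  "length Ks = length Us \<Longrightarrow> CR.combine Ks Us = (\<Sum>i<length Us. Ks ! i * Us ! i)"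
  by (induction Ks Us rule: list_induct2) (simp_all add: sum.lessThan_Suc_shift del: sum.lessThan_Suc)

lemma subfield_Rats: "subfield \<rat> complex_ring"
  by (intro field.subfieldI'[OF field_complex_ring] CR.subringI) auto

text \<open>Connects the type-class notion \<open>algebraic\<close> with the relative notion for
  rings with explicit carrier. The reversed coefficient list of an integer polynomial is a
  legitimate element of \<open>univ_poly\<close> because its head is the nonzero leading
  coefficient.\<close>

lemma algebraic_over_Rats:
  assumes "algebraic x"
  shows "(CR.algebraic over \<rat>) x"
proof -
  obtain p where p: "p \<noteq> 0" "poly (map_poly of_int p) x = 0"
    using assms by (rule algebraicE')
  define P where "P = (of_int_poly p :: complex poly)"
  have P: "P \<noteq> 0" using p(1) by (simp add: P_def)
  have "set (coeffs P) \<subseteq> \<rat>" by (auto simp: P_def coeffs_def)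
  moreover have "hd (rev (coeffs P)) \<noteq> 0" using P by (simp add: hd_rev last_coeffs_eq_coeff_degree)
  ultimately have "rev (coeffs P) \<in> carrier (univ_poly complex_ring \<rat>)"
    unfolding univ_poly_def polynomial_def by simp
  moreover have "rev (coeffs P) \<noteq> []" using P by simp
  moreover have "CR.eval (rev (coeffs P)) x = \<zero>\<^bsub>complex_ring\<^esub>"
    using p(2) unfolding P_def[symmetric] by (simp add: complex_ring_eval)
  ultimately show ?thesis by (rule CR.algebraicI)
qed

lemma Rats_subset_subfield:
  assumes "subfield F complex_ring"
  shows "\<rat> \<subseteq> F"
proof
  note sub = subringE[OF subfieldE(1)[OF assms], simplified]
  have nat: "of_nat n \<in> F" for n
    by (induction n) (use sub in auto)
  have int: "of_int n \<in> F" for n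
    by (cases n) (use nat sub(5) in \<open>auto simp del: of_nat_Suc\<close>)
  fix x :: complex assume "x \<in> \<rat>"
  then obtain a b :: int where ab: "b > 0" "x = of_int a / of_int b" by (rule Rats_cases')
  have "inverse (of_int b) \<in> F"
    using CR.subfield_m_inv(1)[OF assms, of "of_int b"] int ab(1) by simp
  then show "x \<in> F" using int[of a] sub(6) ab(2) by (simp add: divide_inverse)
qed

text \<open>If n is the dimension of the field, the n + 1 powers of z from 1 to z^n are dependent
  over the rationals. To read \<open>CR.dim\<close> as an actual dimension one must know that it is
  finite; for this the generated field is identified with a finite extension by algebraic
  elements.\<close>

lemma int_poly_of_mem_generate_field:
  assumes "finite S" "\<And>x. x \<in> S \<Longrightarrow> algebraic x" "z \<in> generate_field complex_ring S"
  obtains f :: "int poly" where "f \<noteq> 0"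
    "degree f \<le> CR.dim \<rat> (generate_field complex_ring S)" "poly (of_int_poly f) z = 0"
proof -
  define F where "F = generate_field complex_ring S"
  define n where "n = CR.dim \<rat> F"
  obtain xs where xs: "set xs = S" using finite_list[OF assms(1)] by blast
  have F: "subfield F complex_ring"
    unfolding F_def by (rule field.generate_field_is_subfield[OF field_complex_ring]) simp
  have SF: "S \<subseteq> F" by (auto simp: F_def intro: generate_field.incl)
  have alg: "(CR.algebraic over \<rat>) x" if "x \<in> set xs" for x
    using that assms(2) xs algebraic_over_Rats by blast
  \<comment> \<open>Two minimality properties give the two inclusions: \<open>F\<close> lies in
    every subfield containing \<open>S\<close>, and the finite extension lies in every subring
    containing the rationals and \<open>S\<close>.\<close>
  have "subfield (CR.finite_extension \<rat> xs) complex_ring"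
    using alg by (intro CR.finite_extension_is_subfield subfield_Rats) auto
  moreover have "S \<subseteq> CR.finite_extension \<rat> xs"
    using CR.finite_extension_mem[OF subfieldE(1)[OF subfield_Rats], of xs] xs by simp
  ultimately have "F \<subseteq> CR.finite_extension \<rat> xs"
    unfolding F_def by (intro field.generate_field_min_subfield1[OF field_complex_ring]) auto
  moreover have "CR.finite_extension \<rat> xs \<subseteq> F"
    using SF xs by (intro CR.finite_extension_subring_incl subfieldE(1)[OF F] Rats_subset_subfield[OF F]) simp
  ultimately have "CR.finite_extension \<rat> xs = F" by blast
  then have "CR.finite_dimension \<rat> F"
    using CR.finite_extension_finite_dimension(1)[OF subfield_Rats, of xs] alg by auto
  then have dim: "CR.dimension n \<rat> F"
    using CR.finite_dimensionE[OF subfield_Rats] by (simp add: n_def over_def)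
  define Us where "Us = map (\<lambda>i. z ^ i) [0..<Suc n]"
  have z: "z \<in> F" using assms(3) by (simp add: F_def)
  have "z ^ i \<in> F" for i
    using subringE(3,6)[OF subfieldE(1)[OF F]] z by (induction i) auto
  then have "set Us \<subseteq> F" by (auto simp: Us_def)
  then have "\<not> CR.independent \<rat> Us"
    using CR.independent_length_le_dimension[OF subfield_Rats dim, of Us] by (auto simp: Us_def)
  then obtain Ks where Ks: "length Ks = length Us" "CR.combine Ks Us = 0" "set Ks \<subseteq> \<rat>" "set Ks \<noteq> {0}"
    using CR.dependent_imp_non_trivial_combine[OF subfield_Rats, of Us] by auto
  have len: "length Ks = Suc n" using Ks(1) by (simp add: Us_def)
  then have "set Ks \<noteq> {}" by auto
  with Ks(4) have "\<not> set Ks \<subseteq> {0}" by (simp add: subset_singleton_iff)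
  then obtain a where "a \<in> set Ks" "a \<noteq> 0" by blast
  then obtain i0 where i0: "i0 < Suc n" "Ks ! i0 \<noteq> 0" using len by (metis in_set_conv_nth)
  define c where "c = (\<lambda>i. if i \<le> n then Ks ! i else 0)"
  have "(\<Sum>i\<le>n. c i * z ^ i) = (\<Sum>i<length Us. Ks ! i * Us ! i)"
    unfolding Us_def c_def by (rule sum.cong) (auto simp del: upt_Suc)
  also have "\<dots> = 0" using Ks(1,2) by (simp add: complex_ring_combine)
  finally have "(\<Sum>i\<le>n. c i * z ^ i) = 0" .
  moreover have "c i \<in> \<rat>" for i using Ks(3) len by (auto simp: c_def)
  ultimately obtain f where "f \<noteq> 0" "degree f \<le> n" "poly (of_int_poly f) z = 0"
    using int_poly_of_rational_relation[of c z n i0] i0 by (auto simp: c_def)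
  then show ?thesis using that by (simp add: n_def F_def)
qed

subsection \<open>The adjacency operator\<close>

text \<open>Gaussian elimination, one coordinate v at a time: a member j with nonzero value at v
  serves as pivot and clears this coordinate in all other members. The family is indexed, so that
  repeated vectors count separately; powers of an operator applied to one function may
  coincide.\<close>

lemma exists_nontrivial_relation:
  fixes x :: "'i \<Rightarrow> 'a \<Rightarrow> 'b :: field"
  assumes "finite V" "finite I" "card V < card I"
  obtains c where "\<exists>i\<in>I. c i \<noteq> 0" "\<And>v. v \<in> V \<Longrightarrow> (\<Sum>i\<in>I. c i * x i v) = 0"
  using assms
proof (induction V arbitrary: I x thesis rule: finite_induct)
  case empty
  then have "I \<noteq> {}" by auto
  with empty(1)[of "\<lambda>_. 1"] show ?case by auto
next
  case (insert v V)
  show ?case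
  proof (cases "\<forall>i\<in>I. x i v = 0")
    case True
    obtain c where "\<exists>i\<in>I. c i \<noteq> 0" "\<And>w. w \<in> V \<Longrightarrow> (\<Sum>i\<in>I. c i * x i w) = 0"
      using insert.IH[of I x] insert.prems insert.hyps by auto
    with True show ?thesis by (intro insert.prems(1)[of c]) auto
  next
    case False
    then obtain j where j: "j \<in> I" "x j v \<noteq> 0" by blast
    define y where "y = (\<lambda>i w. x i w - x i v / x j v * x j w)"
    have "card V < card (I - {j})" using insert.prems insert.hyps j by simp
    then obtain c where c: "\<exists>i\<in>I - {j}. c i \<noteq> 0" "\<And>w. w \<in> V \<Longrightarrow> (\<Sum>i\<in>I - {j}. c i * y i w) = 0"
      using insert.IH[of "I - {j}" y] insert.prems(2) by auto
    \<comment> \<open>The coefficient of the pivot collects all multiples of \<open>x j\<close> that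
      were subtracted in \<open>y\<close>, so that d relates the \<open>x i\<close> exactly as c
      relates the \<open>y i\<close>.\<close>
    define d where "d = c(j := - (\<Sum>i\<in>I - {j}. c i * x i v) / x j v)"
    have *: "(\<Sum>i\<in>I. d i * x i w) = (\<Sum>i\<in>I - {j}. c i * y i w)" for w
    proof -
      have "(\<Sum>i\<in>I. d i * x i w) = d j * x j w + (\<Sum>i\<in>I - {j}. d i * x i w)"
        using j insert.prems(2) by (simp add: sum.remove)
      also have "(\<Sum>i\<in>I - {j}. d i * x i w) = (\<Sum>i\<in>I - {j}. c i * x i w)"
        by (rule sum.cong) (auto simp: d_def)
      also have "d j * x j w = - (\<Sum>i\<in>I - {j}. c i * (x i v / x j v * x j w))"
        by (simp add: d_def sum_divide_distrib sum_distrib_right mult.assoc)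
      finally show ?thesis by (simp add: y_def right_diff_distrib sum_subtractf)
    qed
    show ?thesis
    proof (rule insert.prems(1)[of d])
      show "\<exists>i\<in>I. d i \<noteq> 0" using c(1) by (auto simp: d_def)
      have "y i v = 0" for i using j by (simp add: y_def)
      then show "(\<Sum>i\<in>I. d i * x i w) = 0" if "w \<in> insert v V" for w
        using that c(2) unfolding * by auto
    qed
  qed
qed

section \<open>Polynomials in the adjacency operator\<close>

definition adj_op :: "('a \<times> 'a) set \<Rightarrow> ('a \<Rightarrow> complex) \<Rightarrow> 'a \<Rightarrow> complex" where
  "adj_op E f v = (\<Sum>w\<in>E `` {v}. f w)"

text \<open>The value of p(A) f at v, where A is \<open>adj_op E\<close>.\<close>

definition poly_adj_op :: "('a \<times> 'a) set \<Rightarrow> complex poly \<Rightarrow> ('a \<Rightarrow> complex) \<Rightarrow> 'a \<Rightarrow> complex" where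
  "poly_adj_op E p f v = (\<Sum>i\<le>degree p. coeff p i * (adj_op E ^^ i) f v)"

lemma adj_op_sum: "adj_op E (\<lambda>v. \<Sum>i\<in>I. c i * f i v) v = (\<Sum>i\<in>I. c i * adj_op E (f i) v)"
  unfolding adj_op_def by (subst sum.swap) (simp add: sum_distrib_left)

lemma poly_adj_op_eq_sum:
  assumes "degree p \<le> n"
  shows "poly_adj_op E p f v = (\<Sum>i\<le>n. coeff p i * (adj_op E ^^ i) f v)"
  unfolding poly_adj_op_def using assms
  by (intro sum.mono_neutral_left) (auto simp: coeff_eq_0)

text \<open>Through this factorisation a root z of a polynomial p with p(A) f = 0 yields the
  candidate q(A) f for an eigenvector, where p = (X - z) q.\<close>

lemma poly_adj_op_linear_factor:
  "poly_adj_op E ([:- z, 1:] * q) f v = adj_op E (poly_adj_op E q f) v - z * poly_adj_op E q f v"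
proof -
  let ?n = "degree q" and ?T = "\<lambda>i. (adj_op E ^^ i) f"
  have "degree ([:- z, 1:] * q) \<le> Suc ?n"
    by (rule order.trans[OF degree_mult_le]) simp
  then have "poly_adj_op E ([:- z, 1:] * q) f v =
      (\<Sum>i\<le>Suc ?n. coeff ([:- z, 1:] * q) i * ?T i v)"
    by (rule poly_adj_op_eq_sum)
  also have "\<dots> = (\<Sum>i\<le>Suc ?n. coeff (pCons 0 q) i * ?T i v) - z * (\<Sum>i\<le>Suc ?n. coeff q i * ?T i v)"
    by (simp only: sum_distrib_left sum_subtractf[symmetric])
      (rule sum.cong, simp_all add: algebra_simps)
  also have "(\<Sum>i\<le>Suc ?n. coeff q i * ?T i v) = poly_adj_op E q f v"
    by (rule poly_adj_op_eq_sum[symmetric]) simp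
  also have "(\<Sum>i\<le>Suc ?n. coeff (pCons 0 q) i * ?T i v) = (\<Sum>i\<le>?n. coeff q i * adj_op E (?T i) v)"
    by (subst sum.atMost_Suc_shift) simp
  also have "\<dots> = adj_op E (poly_adj_op E q f) v"
    unfolding poly_adj_op_def[abs_def] by (rule adj_op_sum[symmetric])
  finally show ?thesis .
qed

section \<open>Self-adjointness and annihilating polynomials with simple roots\<close>

lemma adj_op_eq_sum:
  assumes "finite V" "E \<subseteq> V \<times> V"
  shows "adj_op E f v = (\<Sum>w\<in>V. if (v, w) \<in> E then f w else 0)"
proof -
  have "E `` {v} = {w \<in> V. (v, w) \<in> E}" using assms(2) by blast
  then show ?thesis using assms(1) by (simp add: adj_op_def sum.If_cases Int_def conj_commute)
qed

text \<open>Interchanging the two sums transposes the matrix, which is symmetric and has real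
  entries.\<close>

lemma adj_op_selfadjoint:
  assumes "finite V" "E \<subseteq> V \<times> V" "sym E"
  shows "(\<Sum>v\<in>V. adj_op E f v * cnj (g v)) = (\<Sum>v\<in>V. f v * cnj (adj_op E g v))"
proof -
  have "(\<Sum>v\<in>V. adj_op E f v * cnj (g v)) = (\<Sum>v\<in>V. \<Sum>w\<in>V. if (v, w) \<in> E then f w * cnj (g v) else 0)"
    using assms by (simp add: adj_op_eq_sum sum_distrib_right if_distrib[of "\<lambda>x. x * _"] cong: if_cong)
  also have "\<dots> = (\<Sum>w\<in>V. \<Sum>v\<in>V. if (v, w) \<in> E then f w * cnj (g v) else 0)"
    by (rule sum.swap)
  also have "\<dots> = (\<Sum>v\<in>V. f v * cnj (adj_op E g v))"
    using assms(1,2) symD[OF assms(3)]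
    by (auto simp: adj_op_eq_sum sum_distrib_left if_distrib[of cnj] if_distrib[of "\<lambda>x. _ * x"]
        intro!: sum.cong)
  finally show ?thesis .
qed

text \<open>Put h = (A - z) f, so that A h = z h. If h is nonzero somewhere on V, pairing A h with h
  shows that z is real, and moving A - z to the other side of the pairing of (A - z) f with h gives
  0 for the squared norm of h.\<close>

lemma adj_op_no_generalized_eigenvector:
  assumes "finite V" "E \<subseteq> V \<times> V" "sym E"
    and eig: "\<And>v. adj_op E (\<lambda>v. adj_op E f v - z * f v) v = z * (adj_op E f v - z * f v)"
    and "v \<in> V"
  shows "adj_op E f v = z * f v"
proof (rule ccontr)
  assume neq: "adj_op E f v \<noteq> z * f v"
  define h where "h = (\<lambda>v. adj_op E f v - z * f v)"
  have h: "adj_op E h v = z * h v" for v using eig by (simp add: h_def)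
  define N where "N = (\<Sum>v\<in>V. h v * cnj (h v))"
  have N: "N = of_real (\<Sum>v\<in>V. (norm (h v))\<^sup>2)" unfolding N_def by (simp only: complex_norm_square of_real_sum)
  have "(\<Sum>v\<in>V. (norm (h v))\<^sup>2) > 0"
    using assms(1,5) neq by (intro sum_pos2[of _ v]) (auto simp: h_def)
  then have N0: "N \<noteq> 0" unfolding N by (metis less_irrefl of_real_eq_0_iff)
  have "z * N = (\<Sum>v\<in>V. adj_op E h v * cnj (h v))" by (simp add: h N_def sum_distrib_left mult.assoc)
  also have "\<dots> = cnj z * N"
    unfolding adj_op_selfadjoint[OF assms(1-3)] by (simp add: h N_def sum_distrib_left mult_ac)
  finally have real: "cnj z = z" using N0 by simp
  have "N = (\<Sum>v\<in>V. adj_op E f v * cnj (h v)) - z * (\<Sum>v\<in>V. f v * cnj (h v))"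
    by (simp add: N_def h_def sum_distrib_left left_diff_distrib sum_subtractf mult.assoc)
  also have "(\<Sum>v\<in>V. adj_op E f v * cnj (h v)) = cnj z * (\<Sum>v\<in>V. f v * cnj (h v))"
    unfolding adj_op_selfadjoint[OF assms(1-3)] by (simp add: h sum_distrib_left mult_ac)
  finally show False using N0 real by simp
qed

text \<open>The nonzero value must occur in V: otherwise a function supported outside V would make 0
  an eigenvalue whenever E lies in V \<times> V. Off V the equation then reads z * f v = 0.\<close>

definition adj_eigenvalues :: "'a set \<Rightarrow> ('a \<times> 'a) set \<Rightarrow> complex set" where
  "adj_eigenvalues V E =
    {z. \<exists>f. (\<exists>v\<in>V. f v \<noteq> 0) \<and> (\<forall>v. adj_op E f v = z * f v)}"

lemma adj_op_eq_0: "E \<subseteq> V \<times> V \<Longrightarrow> v \<notin> V \<Longrightarrow> adj_op E f v = 0"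
  unfolding adj_op_def by (rule sum.neutral) auto

text \<open>The polynomial p is chosen of least degree among the nonzero ones with p(A) f = 0. If p
  = (X - z) q, minimality makes q(A) f nonzero, hence an eigenvector for z. As the roots turn out to
  be simple, the degree counts distinct eigenvalues.\<close>

lemma exists_annihilating_poly:
  assumes "finite V" "E \<subseteq> V \<times> V" "sym E" "finite (adj_eigenvalues V E)"
    and supp: "\<And>v. v \<notin> V \<Longrightarrow> f v = 0"
  obtains p where "p \<noteq> 0" "degree p \<le> card (adj_eigenvalues V E)" "\<And>v. poly_adj_op E p f v = 0"
proof -
  have supp_pow: "(adj_op E ^^ i) f v = 0" if "v \<notin> V" for i v
    using that supp adj_op_eq_0[OF assms(2)] by (cases i) auto
  have supp_poly: "poly_adj_op E p f v = 0" if "v \<notin> V" for p v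
    using that by (simp add: poly_adj_op_def supp_pow)
  define P where "P = (\<lambda>p. p \<noteq> 0 \<and> (\<forall>v. poly_adj_op E p f v = 0))"
  \<comment> \<open>The indices from 0 to \<open>card V\<close> are one more than the coordinates,
    so the iterates of f are dependent on V; outside V they all vanish.\<close>
  obtain c where c: "\<exists>i\<in>{..card V}. c i \<noteq> 0"
      "\<And>v. v \<in> V \<Longrightarrow> (\<Sum>i\<le>card V. c i * (adj_op E ^^ i) f v) = 0"
    using exists_nontrivial_relation[OF assms(1), of "{..card V}" "\<lambda>i. (adj_op E ^^ i) f"] by auto
  define p0 where "p0 = (\<Sum>i\<le>card V. monom (c i) i)"
  have cp0: "coeff p0 i = (if i \<le> card V then c i else 0)" for i by (simp add: p0_def coeff_sum)
  have "p0 \<noteq> 0" using c(1) cp0 by (metis atMost_iff coeff_0)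
  moreover have "degree p0 \<le> card V" by (rule degree_le) (simp add: cp0)
  then have "poly_adj_op E p0 f v = (\<Sum>i\<le>card V. c i * (adj_op E ^^ i) f v)" for v
    by (simp add: poly_adj_op_eq_sum cp0)
  then have "poly_adj_op E p0 f v = 0" for v using c(2) supp_poly[of v p0] by (cases "v \<in> V") metis+
  ultimately have "P p0" by (simp add: P_def)
  then obtain p where p: "P p" "\<And>q. P q \<Longrightarrow> degree p \<le> degree q"
    using ex_has_least_nat[of P p0 degree] by auto
  have p0: "p \<noteq> 0" and pf: "\<And>v. poly_adj_op E p f v = 0" using p(1) by (auto simp: P_def)
  have nonvanish: "\<exists>v\<in>V. poly_adj_op E q f v \<noteq> 0" if "p = [:- z, 1:] * q" for q z
  proof -
    have "q \<noteq> 0" using that p0 by auto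
    moreover have "degree q < degree p" using \<open>q \<noteq> 0\<close> unfolding that by (subst degree_mult_eq) auto
    ultimately have "\<not> (\<forall>v. poly_adj_op E q f v = 0)" using p(2)[of q] by (auto simp: P_def)
    then show ?thesis using supp_poly by blast
  qed
  \<comment> \<open>A double root would give g = s(A) f with (A - z)^2 g = 0. Self-adjointness then
    yields (A - z) g = 0 on V, against the minimality of p.\<close>
  have "\<not> [:- z, 1:] * [:- z, 1:] dvd p" for z
  proof
    assume "[:- z, 1:] * [:- z, 1:] dvd p"
    then obtain s where "p = [:- z, 1:] * [:- z, 1:] * s" by (elim dvdE)
    then have s: "p = [:- z, 1:] * ([:- z, 1:] * s)" by (simp only: mult.assoc)
    define g where "g = poly_adj_op E s f"
    have g: "poly_adj_op E ([:- z, 1:] * s) f = (\<lambda>v. adj_op E g v - z * g v)"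
      unfolding g_def by (rule ext) (rule poly_adj_op_linear_factor)
    have "adj_op E (\<lambda>v. adj_op E g v - z * g v) v = z * (adj_op E g v - z * g v)" for v
      using pf[of v] unfolding s poly_adj_op_linear_factor[of E z "[:- z, 1:] * s"] g by simp
    then have "adj_op E g v = z * g v" if "v \<in> V" for v
      using adj_op_no_generalized_eigenvector[OF assms(1-3)] that by blast
    then show False using nonvanish[OF s] unfolding g by simp
  qed
  then have "Polynomial.order z p < 2" for z using order_divides[of z 2 p] p0 by (auto simp: power2_eq_square)
  then have "rsquarefree p" using p0 by (simp add: rsquarefree_def less_2_cases_iff)
  then have "degree p = card {z. poly p z = 0}" using rsquarefree_card_degree[OF p0] by simp
  moreover have "{z. poly p z = 0} \<subseteq> adj_eigenvalues V E"
  proof clarify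
    fix z assume "poly p z = 0"
    then obtain q where q: "p = [:- z, 1:] * q" by (auto simp: poly_eq_0_iff_dvd elim: dvdE)
    have "adj_op E (poly_adj_op E q f) v = z * poly_adj_op E q f v" for v
      using pf[of v] unfolding q poly_adj_op_linear_factor by simp
    then show "z \<in> adj_eigenvalues V E" using nonvanish[OF q] by (auto simp: adj_eigenvalues_def)
  qed
  ultimately have "degree p \<le> card (adj_eigenvalues V E)" using assms(4) by (simp add: card_mono)
  then show ?thesis using that p0 pf by blast
qed

section \<open>Walk counts and the bound on the number of vertices\<close>

lemma adj_op_pow_eq_walk_count:
  assumes "finite E"
  shows "\<exists>n :: nat. (adj_op E ^^ i) (\<lambda>v. if v = u then 1 else 0) v = of_nat n \<and> (n > 0 \<longleftrightarrow> (v, u) \<in> E ^^ i)"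
proof (induction i arbitrary: v)
  case 0
  show ?case by (rule exI[of _ "if v = u then 1 else 0"]) auto
next
  case (Suc i)
  then obtain n where n: "\<And>v. (adj_op E ^^ i) (\<lambda>v. if v = u then 1 else 0) v = of_nat (n v)"
      "\<And>v. n v > 0 \<longleftrightarrow> (v, u) \<in> E ^^ i" by metis
  have "finite (E `` {v})" using assms by (rule finite_Image)
  \<comment> \<open>The counts are natural numbers, so nothing cancels: the sum is positive exactly
    if some out-neighbour of v starts a walk of length i to u.\<close>
  then have "(\<Sum>w\<in>E `` {v}. n w) > 0 \<longleftrightarrow> (\<exists>w. (v, w) \<in> E \<and> (w, u) \<in> E ^^ i)"
    by (auto simp: sum_nonneg_eq_0_iff n(2)[symmetric] simp flip: neq0_conv)
  also have "\<dots> \<longleftrightarrow> (v, u) \<in> E ^^ Suc i" by (meson relpow_Suc_D2 relpow_Suc_I2)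
  finally show ?case by (intro exI[of _ "\<Sum>w\<in>E `` {v}. n w"]) 
    (simp add: adj_op_def[of E "(adj_op E ^^ i) _"] n(1))
qed

lemma card_relpow_predecessors_le:
  fixes E :: "('a \<times> 'a) set"
  assumes "finite E" "\<And>w. card {v. (v, w) \<in> E} \<le> d"
  shows "finite {v. (v, u) \<in> E ^^ i} \<and> card {v. (v, u) \<in> E ^^ i} \<le> d ^ i"
proof (induction i)
  case 0
  have "{v. (v, u) \<in> E ^^ 0} = {u}" by auto
  then show ?case by simp
next
  case (Suc i)
  have fin: "finite {v. (v, w) \<in> E}" for w
    by (rule finite_subset[OF _ finite_imageI[OF assms(1), of fst]]) force
  have eq: "{v. (v, u) \<in> E ^^ Suc i} = (\<Union>w\<in>{w. (w, u) \<in> E ^^ i}. {v. (v, w) \<in> E})"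
    by (auto intro: relpow_Suc_I2 dest: relpow_Suc_D2 simp del: relpow.simps)
  have "card {v. (v, u) \<in> E ^^ Suc i} \<le> (\<Sum>w\<in>{w. (w, u) \<in> E ^^ i}. card {v. (v, w) \<in> E})"
    unfolding eq using Suc by (intro card_UN_le) simp
  also have "\<dots> \<le> card {w. (w, u) \<in> E ^^ i} * d"
    using sum_mono[of "{w. (w, u) \<in> E ^^ i}" "\<lambda>w. card {v. (v, w) \<in> E}" "\<lambda>_. d"] assms(2) by simp
  also have "\<dots> \<le> d ^ Suc i" using Suc by simp
  finally show ?case using Suc fin unfolding eq by blast
qed

text \<open>The set \<open>R\<close> of points with a walk to u of length less than the degree of
  the annihilating polynomial is closed under predecessors, so it contains V. Tracing walks back
  from u multiplies the count by at most d per step, whence the geometric sum.\<close>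

lemma card_le_of_card_adj_eigenvalues:
  assumes "finite V" "E \<subseteq> V \<times> V" "sym E" "finite (adj_eigenvalues V E)"
    and "\<And>u v. u \<in> V \<Longrightarrow> v \<in> V \<Longrightarrow> (u, v) \<in> E\<^sup>*"
    and "\<And>w. card (E `` {w}) \<le> d"
  shows "card V \<le> (\<Sum>i<card (adj_eigenvalues V E). d ^ i)"
proof (cases "V = {}")
  case False
  then obtain u where u: "u \<in> V" by blast
  have finE: "finite E" using assms(1,2) finite_subset by blast
  define e where "e = (\<lambda>v. if v = u then 1 else 0 :: complex)"
  obtain p where p: "p \<noteq> 0" "degree p \<le> card (adj_eigenvalues V E)" "\<And>v. poly_adj_op E p e v = 0"
    using exists_annihilating_poly[OF assms(1-4), of e] u unfolding e_def by metis
  let ?m = "degree p"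
  have walk: "(adj_op E ^^ i) e v \<noteq> 0 \<longleftrightarrow> (v, u) \<in> E ^^ i" for i v
    using adj_op_pow_eq_walk_count[OF finE, of i u v] unfolding e_def by auto
  define R where "R = (\<Union>i<?m. {v. (v, u) \<in> E ^^ i})"
  have top: "v \<in> R" if "(v, u) \<in> E ^^ ?m" for v
  proof (rule ccontr)
    assume "v \<notin> R"
    then have "(adj_op E ^^ i) e v = 0" if "i < ?m" for i using that walk by (auto simp: R_def)
    \<comment> \<open>With no shorter walk from v to u, every term below the leading one vanishes at
      v.\<close>
    then have "poly_adj_op E p e v = lead_coeff p * (adj_op E ^^ ?m) e v"
      unfolding poly_adj_op_def by (simp add: atMost_Suc flip: lessThan_Suc_atMost)
    moreover have "(adj_op E ^^ ?m) e v \<noteq> 0" using walk that by blast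
    ultimately show False using p(1,3) by simp
  qed
  have step: "v \<in> R" if vw: "(v, w) \<in> E" and "w \<in> R" for v w
  proof -
    obtain i where i: "i < ?m" "(w, u) \<in> E ^^ i" using \<open>w \<in> R\<close> by (auto simp: R_def)
    then have "(v, u) \<in> E ^^ Suc i" using relpow_Suc_I2[OF vw] by blast
    then show ?thesis using i(1) top by (cases "Suc i = ?m") (auto simp: R_def simp del: relpow.simps)
  qed
  have "u \<in> R" using top[of u] by (cases "?m = 0") (auto simp: R_def intro!: bexI[of _ 0])
  have "V \<subseteq> R"
  proof
    fix v assume "v \<in> V"
    then have "(v, u) \<in> E\<^sup>*" using assms(5) u by blast
    then show "v \<in> R" by (induction rule: converse_rtrancl_induct) (use \<open>u \<in> R\<close> step in auto)
  qed
  have "{v. (v, w) \<in> E} = E `` {w}" for w using symD[OF assms(3)] by blast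
  then have pre: "finite {v. (v, u) \<in> E ^^ i} \<and> card {v. (v, u) \<in> E ^^ i} \<le> d ^ i" for i
    using assms(6) by (intro card_relpow_predecessors_le[OF finE]) simp
  have "card V \<le> card R" using \<open>V \<subseteq> R\<close> pre by (intro card_mono) (auto simp: R_def)
  also have "\<dots> \<le> (\<Sum>i<?m. card {v. (v, u) \<in> E ^^ i})" unfolding R_def by (rule card_UN_le) simp
  also have "\<dots> \<le> (\<Sum>i<?m. d ^ i)" using pre by (intro sum_mono) simp
  also have "\<dots> \<le> (\<Sum>i<card (adj_eigenvalues V E). d ^ i)" using p(2) by (intro sum_mono2) auto
  finally show ?thesis .
qed simp

text \<open>Evaluate the eigenvalue equation at a vertex where the eigenfunction has maximal
  absolute value.\<close>

lemma norm_adj_eigenvalue_le: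
  assumes "finite V" "E \<subseteq> V \<times> V" "\<And>w. card (E `` {w}) \<le> d" "z \<in> adj_eigenvalues V E"
  shows "norm z \<le> real d"
proof -
  obtain f v0 where f: "v0 \<in> V" "f v0 \<noteq> 0" "\<And>v. adj_op E f v = z * f v"
    using assms(4) by (auto simp: adj_eigenvalues_def)
  define M where "M = Max ((\<lambda>v. norm (f v)) ` V)"
  have le: "norm (f w) \<le> M" if "w \<in> V" for w using that assms(1) by (simp add: M_def)
  have "M \<in> (\<lambda>v. norm (f v)) ` V" unfolding M_def using assms(1) f(1) by (intro Max_in) auto
  then obtain v where v: "v \<in> V" "norm (f v) = M" by auto
  have M: "M > 0" using le[OF f(1)] f(2) by (metis norm_le_zero_iff not_le order.strict_trans1 zero_less_norm_iff)
  have "norm z * M = norm (\<Sum>w\<in>E `` {v}. f w)"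
    using f(3)[of v] v(2) by (simp add: adj_op_def norm_mult)
  also have "\<dots> \<le> (\<Sum>w\<in>E `` {v}. M)" using assms(2) le by (intro sum_norm_le) auto
  also have "\<dots> \<le> real d * M" using assms(3)[of v] M by (simp add: mult_right_mono)
  finally show ?thesis using M by simp
qed

subsection \<open>Finiteness\<close>

text \<open>The enumeration of the vertices carries vectors to functions on the vertex set and
  matrix multiplication to \<open>adj_op\<close>.\<close>

lemma spectrum_adjacency_matrix:
  assumes "finite (pverts G)" "parcs G \<subseteq> pverts G \<times> pverts G"
  shows "spectrum (adjacency_matrix G) = adj_eigenvalues (pverts G) (parcs G)"
proof -
  define vs where "vs = vertex_list G"
  define n where "n = length vs"
  let ?A = "adjacency_matrix G" and ?V = "pverts G" and ?E = "parcs G"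
  have vs: "distinct vs" "set vs = ?V" using vertex_list[OF assms(1)] by (simp_all add: vs_def)
  have A: "?A = mat n n (\<lambda>(i, j). if (vs ! i, vs ! j) \<in> ?E then 1 else 0)"
    by (simp add: adjacency_matrix_def vs_def n_def Let_def)
  have bij: "bij_betw ((!) vs) {0..<n} ?V"
    using vs by (auto simp: n_def intro!: bij_betw_nth)
  have mult: "(?A *\<^sub>v x) $ i = adj_op ?E f (vs ! i)"
    if "i < n" "x \<in> carrier_vec n" "\<And>j. j < n \<Longrightarrow> x $ j = f (vs ! j)"
    for x :: "complex vec" and f i
  proof -
    have "(?A *\<^sub>v x) $ i = (\<Sum>j = 0..<n. if (vs ! i, vs ! j) \<in> ?E then f (vs ! j) else 0)"
      using that by (auto simp: A scalar_prod_def intro!: sum.cong)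
    also have "\<dots> = (\<Sum>w\<in>?V. if (vs ! i, w) \<in> ?E then f w else 0)"
      by (rule sum.reindex_bij_betw[OF bij])
    finally show ?thesis by (simp add: adj_op_eq_sum[OF assms])
  qed
  have "eigenvalue ?A z \<longleftrightarrow> z \<in> adj_eigenvalues ?V ?E" for z
  proof
    assume "eigenvalue ?A z"
    then obtain x where x: "x \<in> carrier_vec n" "x \<noteq> 0\<^sub>v n" "?A *\<^sub>v x = z \<cdot>\<^sub>v x"
      by (auto simp: eigenvalue_def eigenvector_def A)
    \<comment> \<open>The default 0 makes the eigenvalue equation hold outside the vertex set, where
      \<open>adj_op\<close> vanishes too.\<close>
    define f where "f = (\<lambda>v. if v \<in> ?V then x $ the_inv_into {0..<n} ((!) vs) v else 0)"
    have f: "x $ j = f (vs ! j)" if "j < n" for j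
      using that vs(2) bij by (auto simp: f_def n_def bij_betw_def the_inv_into_f_f)
    have nth: "\<exists>i<n. v = vs ! i" if "v \<in> ?V" for v
      using that vs(2) by (metis in_set_conv_nth n_def)
    obtain i where i: "i < n" "x $ i \<noteq> 0" using x(1,2) by (auto simp: vec_eq_iff)
    have "adj_op ?E f v = z * f v" for v
    proof (cases "v \<in> ?V")
      case True
      then obtain i where i: "i < n" "v = vs ! i" using nth by blast
      then have "adj_op ?E f v = (z \<cdot>\<^sub>v x) $ i" using mult[OF i(1) x(1) f] x(3) by simp
      then show ?thesis using i x(1) f by simp
    next
      case False
      then show ?thesis using adj_op_eq_0[OF assms(2)] by (simp add: f_def)
    qed
    moreover have "vs ! i \<in> ?V" using i(1) vs(2) by (metis n_def nth_mem)
    ultimately show "z \<in> adj_eigenvalues ?V ?E"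
      using f[OF i(1)] i(2) unfolding adj_eigenvalues_def by auto
  next
    assume "z \<in> adj_eigenvalues ?V ?E"
    then obtain f v where f: "v \<in> ?V" "f v \<noteq> 0" "\<And>v. adj_op ?E f v = z * f v"
      by (auto simp: adj_eigenvalues_def)
    define x where "x = vec n (\<lambda>i. f (vs ! i))"
    obtain i where i: "i < n" "v = vs ! i" using f(1) vs(2) by (metis in_set_conv_nth n_def)
    then have "x $ i \<noteq> 0" using f(2) by (simp add: x_def)
    then have "x \<noteq> 0\<^sub>v n" using i(1) by auto
    moreover have "?A *\<^sub>v x = z \<cdot>\<^sub>v x"
    proof (rule eq_vecI)
      fix j assume "j < dim_vec (z \<cdot>\<^sub>v x)"
      then have j: "j < n" by (simp add: x_def)
      then show "(?A *\<^sub>v x) $ j = (z \<cdot>\<^sub>v x) $ j"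
        using mult[OF j, of x f] f(3) by (simp add: x_def)
    qed (simp add: A x_def)
    ultimately have "eigenvector ?A x z" by (simp add: eigenvector_def A x_def)
    then show "eigenvalue ?A z" unfolding eigenvalue_def by blast
  qed
  then show ?thesis by (auto simp: spectrum_def)
qed

text \<open>The entries are integers, so the characteristic polynomial is that of an integer matrix.
  Thus eigenvalues are algebraic integers, and their conjugates are again eigenvalues.\<close>

lemma spectrum_adjacency_matrix_int_poly:
  fixes G :: "'a pair_pre_digraph"
  obtains \<chi> :: "int poly" where "lead_coeff \<chi> = 1"
    "\<And>z. z \<in> spectrum (adjacency_matrix G) \<longleftrightarrow> poly (of_int_poly \<chi>) z = 0"
proof -
  define vs where "vs = vertex_list G"
  define n where "n = length vs"
  define B :: "int mat" where "B = mat n n (\<lambda>(i, j). if (vs ! i, vs ! j) \<in> parcs G then 1 else 0)"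
  have B: "B \<in> carrier_mat n n" by (simp add: B_def)
  have A: "adjacency_matrix G = map_mat of_int B"
    by (rule eq_matI) (auto simp: adjacency_matrix_def B_def vs_def n_def Let_def)
  have "char_poly (adjacency_matrix G) = of_int_poly (char_poly B)"
    unfolding A by (rule of_int_hom.char_poly_hom[OF B])
  moreover have "adjacency_matrix G \<in> carrier_mat n n" unfolding A using B by simp
  ultimately have "spectrum (adjacency_matrix G) = {z. poly (of_int_poly (char_poly B)) z = 0}"
    by (simp add: spectrum_root_char_poly)
  moreover have "lead_coeff (char_poly B) = 1" using degree_monic_char_poly[OF B] by simp
  ultimately show ?thesis using that[of "char_poly B"] by simp
qed

lemma finite_spectrum_adjacency_matrix: "finite (spectrum (adjacency_matrix G))"
  by (rule card_finite_spectrum(1)[of _ "length (vertex_list G)"])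
    (simp add: adjacency_matrix_def Let_def)

lemma int_poly_of_mem_spectrum:
  fixes G :: "'a pair_pre_digraph"
  assumes "z \<in> spectrum (adjacency_matrix G)"
  obtains f :: "int poly" where "f \<noteq> 0" "degree f \<le> algebraic_degree G" "poly (of_int_poly f) z = 0"
proof -
  obtain \<chi> :: "int poly" where \<chi>: "lead_coeff \<chi> = 1"
    "\<And>z. z \<in> spectrum (adjacency_matrix G) \<longleftrightarrow> poly (of_int_poly \<chi>) z = 0"
    using spectrum_adjacency_matrix_int_poly[of G] by metis
  have "algebraic x" if "x \<in> spectrum (adjacency_matrix G)" for x
    using that \<chi> by (intro algebraicI[of "of_int_poly \<chi>"]) auto
  then show ?thesis
    using int_poly_of_mem_generate_field[OF finite_spectrum_adjacency_matrix[of G], of z] that assms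
    by (auto simp: algebraic_degree_def splitting_field_def intro: generate_field.incl)
qed

section \<open>Arcs of a graph: symmetry, degrees and reachability\<close>

lemma pair_graph_props:
  assumes "pair_graph G"
  shows "finite (pverts G)" "parcs G \<subseteq> pverts G \<times> pverts G" "sym (parcs G)"
    and "card (parcs G `` {v}) \<le> max_degree G"
proof -
  interpret pair_graph G by (rule assms)
  show fin: "finite (pverts G)" by (rule pair_finite_verts)
  show sub: "parcs G \<subseteq> pverts G \<times> pverts G" using in_arcsD1 in_arcsD2 by auto
  show "sym (parcs G)" using pair_sym_arcs by (simp add: symmetric_def)
  show "card (parcs G `` {v}) \<le> max_degree G"
  proof (cases "v \<in> pverts G")
    case True
    have "out_arcs (with_proj G) v = Pair v ` (parcs G `` {v})" by (auto simp: out_arcs_def)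
    then have "out_degree (with_proj G) v = card (parcs G `` {v})"
      by (simp add: out_degree_def card_image inj_on_def)
    then show ?thesis unfolding max_degree_def using True fin by (metis Max_ge finite_imageI imageI)
  next
    case False
    then have "parcs G `` {v} = {}" using sub by blast
    then show ?thesis by (simp only: card.empty)
  qed
qed

text \<open>Connectedness is strong connectedness of the symmetric closure, which has the same arcs
  when the arc set is already symmetric.\<close>

lemma connected_imp_rtrancl:
  assumes "pair_graph G" "Digraph_Component.connected (with_proj G)" "u \<in> pverts G" "v \<in> pverts G"
  shows "(u, v) \<in> (parcs G)\<^sup>*"
proof -
  interpret pair_graph G by (rule assms)
  have "u \<rightarrow>\<^sup>*\<^bsub>with_proj (mk_symmetric (with_proj G))\<^esub> v"
    using assms(2-4) unfolding connected_def strongly_connected_def by simp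
  then have "(u, v) \<in> (parcs (mk_symmetric (with_proj G)))\<^sup>*"
    using reachable_rtranclI by fastforce
  moreover have "parcs (mk_symmetric (with_proj G)) = parcs G"
    using symD[OF pair_graph_props(3)[OF assms(1)]] by (force simp: parcs_mk_symmetric)
  ultimately show ?thesis by simp
qed

section \<open>Isomorphism classes of graphs with boundedly many vertices\<close>

definition adjacency_pattern :: "'a pair_pre_digraph \<Rightarrow> nat \<times> (nat \<times> nat) set" where
  "adjacency_pattern G = (let vs = vertex_list G; n = length vs in
     (n, {(i, j). i < n \<and> j < n \<and> (vs ! i, vs ! j) \<in> parcs G}))"

text \<open>The isomorphism sends the i-th vertex of G to the i-th vertex of H. Patterns depend on
  the chosen enumerations, so isomorphic graphs may have different ones; for finiteness it is enough
  that equal patterns force isomorphism.\<close>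

lemma graph_iso_of_adjacency_pattern_eq:
  assumes "pair_graph G" "pair_graph H" "adjacency_pattern G = adjacency_pattern H"
  shows "(G, H) \<in> graph_iso_rel"
proof -
  interpret pair_graph G by (rule assms)
  define vs ws n where "vs = vertex_list G" and "ws = vertex_list H" and "n = length vs"
  have vs: "distinct vs" "set vs = pverts G"
    using vertex_list[OF pair_graph_props(1)[OF assms(1)]] by (simp_all add: vs_def)
  have ws: "distinct ws" "set ws = pverts H"
    using vertex_list[OF pair_graph_props(1)[OF assms(2)]] by (simp_all add: ws_def)
  have len: "length ws = n"
    and pat: "\<And>i j. i < n \<Longrightarrow> j < n \<Longrightarrow> (vs ! i, vs ! j) \<in> parcs G \<longleftrightarrow> (ws ! i, ws ! j) \<in> parcs H"
    using assms(3) by (auto simp: adjacency_pattern_def Let_def vs_def ws_def n_def)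
  have bij_vs: "bij_betw ((!) vs) {..<n} (pverts G)" using vs by (auto simp: n_def intro!: bij_betw_nth)
  have bij_ws: "bij_betw ((!) ws) {..<n} (pverts H)" using ws len by (auto intro!: bij_betw_nth)
  define h where "h = (\<lambda>v. ws ! the_inv_into {..<n} ((!) vs) v)"
  have h_nth: "h (vs ! i) = ws ! i" if "i < n" for i
    using that bij_vs by (auto simp: h_def bij_betw_def the_inv_into_f_f)
  have bij_h: "bij_betw h (pverts G) (pverts H)"
    using bij_betw_trans[OF bij_betw_the_inv_into[OF bij_vs] bij_ws] by (simp add: h_def[abs_def] o_def)
  have arcs: "map_prod h h ` parcs G = parcs H"
  proof (intro equalityI subsetI)
    fix e assume "e \<in> map_prod h h ` parcs G"
    then obtain a b where ab: "(a, b) \<in> parcs G" "e = (h a, h b)" by auto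
    then obtain i j where "i < n" "a = vs ! i" "j < n" "b = vs ! j"
      using in_arcsD1 in_arcsD2 vs(2) n_def by (metis in_set_conv_nth)
    then show "e \<in> parcs H" using ab pat h_nth by simp
  next
    fix e assume e: "e \<in> parcs H"
    obtain a b where ab: "e = (a, b)" by (cases e)
    then have "a \<in> pverts H" "b \<in> pverts H" using e pair_graph_props(2)[OF assms(2)] by auto
    then obtain i j where ij: "i < n" "a = ws ! i" "j < n" "b = ws ! j"
      using ws(2) len by (metis in_set_conv_nth)
    then have "(vs ! i, vs ! j) \<in> parcs G" using e ab pat by simp
    then show "e \<in> map_prod h h ` parcs G"
      using ij ab h_nth by (intro image_eqI[of _ _ "(vs ! i, vs ! j)"]) auto
  qed
  let ?f = "\<lparr>iso_verts = h, iso_arcs = map_prod h h, iso_head = snd, iso_tail = fst\<rparr>"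
  have inj: "inj_on h (pverts G)" using bij_h by (simp add: bij_betw_def)
  then have "inj_on (map_prod h h) (pverts G \<times> pverts G)" using map_prod_inj_on by blast
  then have "inj_on (map_prod h h) (parcs G)"
    using pair_graph_props(2)[OF assms(1)] inj_on_subset by blast
  then have "pre_digraph.digraph_isomorphism (with_proj G) ?f"
    using inj wf_digraph_axioms by (simp add: pre_digraph.digraph_isomorphism_def)
  moreover have "with_proj H = app_iso ?f (with_proj G)"
    using bij_h arcs by (simp add: app_iso_def with_proj_def bij_betw_def)
  ultimately show ?thesis using assms(1,2) by (auto simp: graph_iso_rel_def digraph_iso_def)
qed

lemma finite_quotient_of_card_bounded:
  assumes "\<And>G. G \<in> A \<Longrightarrow> pair_graph G \<and> card (pverts G) \<le> m"
  shows "finite (A // graph_iso_rel)"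
proof -
  \<comment> \<open>Recovers a class from a pattern: all classes in the union coincide, since
    members of \<open>A\<close> with equal patterns are isomorphic.\<close>
  define C where "C = (\<lambda>p. \<Union>{graph_iso_rel `` {G} |G. G \<in> A \<and> adjacency_pattern G = p})"
  have "graph_iso_rel `` {G} = C (adjacency_pattern G)" if "G \<in> A" for G
  proof -
    have "graph_iso_rel `` {H} = graph_iso_rel `` {G}" if "H \<in> A" "adjacency_pattern H = adjacency_pattern G" for H
      using graph_iso_of_adjacency_pattern_eq assms that \<open>G \<in> A\<close>
      by (intro equiv_class_eq[OF equiv_graph_iso_rel]) blast
    then show ?thesis using that unfolding C_def by blast
  qed
  then have "A // graph_iso_rel \<subseteq> C ` adjacency_pattern ` A"
    by (auto simp: quotient_def)
  moreover have "adjacency_pattern ` A \<subseteq> {..m} \<times> Pow ({..<m} \<times> {..<m})"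
  proof (rule image_subsetI)
    fix G assume "G \<in> A"
    then have "finite (pverts G)" "card (pverts G) \<le> m"
      using assms pair_graph_props(1) by blast+
    then have "length (vertex_list G) \<le> m" using vertex_list distinct_card by metis
    then show "adjacency_pattern G \<in> {..m} \<times> Pow ({..<m} \<times> {..<m})"
      by (auto simp: adjacency_pattern_def Let_def)
  qed
  then have "finite (adjacency_pattern ` A)" by (rule finite_subset) simp
  ultimately show ?thesis using finite_surj by blast
qed

theorem theorem3p2:
  fixes k \<Delta> :: nat
  assumes "k > 0" and "\<Delta> > 0"
  shows "finite ({G :: 'a pair_pre_digraph. pair_graph G \<and> Digraph_Component.connected (with_proj G) \<and>
                    algebraic_degree G \<le> k \<and> max_degree G \<le> \<Delta>} // graph_iso_rel)"
proof -
  \<comment> \<open>This set depends only on k and \<Delta> and will contain the eigenvalues of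
    every graph considered, so its size bounds the number of distinct eigenvalues uniformly.\<close>
  define Z where "Z = {z :: complex. \<exists>\<chi> f :: int poly. lead_coeff \<chi> = 1 \<and> poly (of_int_poly \<chi>) z = 0 \<and>
      (\<forall>w :: complex. poly (of_int_poly \<chi>) w = 0 \<longrightarrow> norm w \<le> real \<Delta>) \<and>
      f \<noteq> 0 \<and> degree f \<le> k \<and> poly (of_int_poly f) z = 0}"
  have Z: "finite Z" unfolding Z_def by (rule finite_bounded_degree_bounded_conjugates)
  have "card (pverts G) \<le> (\<Sum>i<card Z. \<Delta> ^ i)"
    if G: "pair_graph G" "Digraph_Component.connected (with_proj G)"
      and bounds: "algebraic_degree G \<le> k" "max_degree G \<le> \<Delta>" for G :: "'a pair_pre_digraph"
  proof -
    note props = pair_graph_props[OF G(1)]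
    let ?S = "adj_eigenvalues (pverts G) (parcs G)"
    have S: "spectrum (adjacency_matrix G) = ?S" by (rule spectrum_adjacency_matrix[OF props(1,2)])
    have deg: "card (parcs G `` {w}) \<le> \<Delta>" for w using props(4)[of w] bounds(2) by (rule order.trans)
    obtain \<chi> :: "int poly" where \<chi>: "lead_coeff \<chi> = 1" "\<And>z. z \<in> ?S \<longleftrightarrow> poly (of_int_poly \<chi>) z = 0"
      using spectrum_adjacency_matrix_int_poly[of G] unfolding S by metis
    \<comment> \<open>The roots of \<chi> are exactly the eigenvalues of G, so the bound \<Delta>
      holds for all of them, as \<open>Z\<close> demands; f comes from the algebraic degree.\<close>
    have "?S \<subseteq> Z"
    proof
      fix z assume z: "z \<in> ?S"
      then obtain f :: "int poly" where "f \<noteq> 0" "degree f \<le> algebraic_degree G" "poly (of_int_poly f) z = 0"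
        using int_poly_of_mem_spectrum[of z G] unfolding S by metis
      moreover have "norm w \<le> real \<Delta>" if "w \<in> ?S" for w
        by (rule norm_adj_eigenvalue_le[OF props(1,2) deg that])
      ultimately show "z \<in> Z" unfolding Z_def using \<chi> z bounds(1) by (blast intro: order.trans)
    qed
    then have "card ?S \<le> card Z" "finite ?S" using Z by (auto intro: card_mono finite_subset)
    have "card (pverts G) \<le> (\<Sum>i<card ?S. \<Delta> ^ i)"
      using connected_imp_rtrancl[OF G] \<open>finite ?S\<close>
      by (intro card_le_of_card_adj_eigenvalues props(1-3) deg)
    also have "\<dots> \<le> (\<Sum>i<card Z. \<Delta> ^ i)" using \<open>card ?S \<le> card Z\<close> by (intro sum_mono2) auto
    finally show ?thesis .
  qed
  then show ?thesis by (intro finite_quotient_of_card_bounded) blast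
qed

end
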